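(* Let $G$ be a strategic game with parametrized preferences for $n$ players with strategy sets $S_1,\ldots,S_n$, and let $\mathcal{N}(G)$ be the associated CP-net. Then a joint strategy $s\in S_1\times\cdots\times S_n$ is a Nash equilibrium of $G$ if and only if $s$ is an optimal outcome of $\mathcal{N}(G)$.
   Context: A preference on a set $A$ is a strict linear ordering on $A$; $\succeq$ denotes the corresponding weak preference ($a \succeq b$ iff $a \succ b$ or $a=b$). **Games.** A strategic game with parametrized preferences for $n$ players consists of a finite non-empty set $S_i$ of strategies for each player $i$ and, for each $i$ and each $s_{-i}\in S_{-i} := \prod_{j\ne i} S_j$, a preference $\succ(s_{-i})$ on $S_i$. A joint strategy $s\in S_1\times\cdots\times S_n$ is a (pure) Nash equilibrium if for all $i$ and all $s_i'\in S_i$, $s_i \succeq(s_{-i})\ s_i'$, where $s_{-i}$ is $s$ with its $i$th component removed. **CP-nets.** A CP-net consists of variables $X_1,\ldots,X_n$ with finite non-empty domains $\mathcal{D}(X_i)$; for each $i$ a (possibly empty) set of parents $Pa(X_i) = \{X_{i_1},\ldots,X_{i_k}\} \subseteq \{X_1,\ldots,X_n\}\setminus\{X_i\}$, with index sequence $I = i_1,\ldots,i_k$; and for each $i$ and each complete assignment $a_I \in \mathcal{D}(X_{i_1})\times\cdots\times\mathcal{D}(X_{i_k})$ exactly one preference statement $X_I = a_I : \succ(a_I)$, where $\succ(a_I)$ is a preference on $\mathcal{D}(X_i)$. An outcome is an element $s=(s_1,\ldots,s_n)$ of $\mathcal{D}(X_1)\times\cdots\times\mathcal{D}(X_n)$.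 A worsening flip is a transition from an outcome $\alpha$ to an outcome $\beta$ that differ in the value of a single variable $X_i$, where $\alpha_i$ is preferred to $\beta_i$ in the unique preference statement for $X_i$ determined by the (common) values of $\alpha,\beta$ on $Pa(X_i)$. An outcome $\alpha$ is better than $\beta$, written $\alpha\succ\beta$, iff there is a chain of (one or more) worsening flips from $\alpha$ to $\beta$. An outcome is optimal if no better outcome exists. **The CP-net $\mathcal{N}(G)$.** Given a game $G$, $\mathcal{N}(G)$ has one variable $X_i$ for each player $i$, with $\mathcal{D}(X_i) = S_i$ and $Pa(X_i) = \{X_j : j\neq i\}$. For each joint strategy $s_{-i}$ of the opponents of player $i$, the preference statement for $X_i$ is $X_{-i} = s_{-i}:\ \succ(s_{-i})$, where $\succ(s_{-i})$ is the preference of player $i$ in $G$ associated with $s_{-i}$. *)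

theory Defs
  imports "HOL-Library.FuncSet"
begin

text \<open>
  Preferences are relations whose pairs \<open>(a, b)\<close> are read as ``\<open>a\<close> is strictly preferred to
  \<open>b\<close>''. The inclusion in \<open>A \<times> A\<close> is required because \<^const>\<open>strict_linear_order_on\<close>
  does not confine the relation to its carrier.
\<close>

definition preference_on :: "'a set \<Rightarrow> 'a rel \<Rightarrow> bool" where
  "preference_on A r \<longleftrightarrow> r \<subseteq> A \<times> A \<and> strict_linear_order_on A r"

definition weakly_preferred :: "'a rel \<Rightarrow> 'a \<Rightarrow> 'a \<Rightarrow> bool" where
  "weakly_preferred r a b \<longleftrightarrow> (a, b) \<in> r \<or> a = b"

text \<open>
  Players, and likewise the variables of a CP-net, are the numbers \<open>1, \<dots>, n\<close>. Tuples indexed by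
  a set \<open>I\<close> of players are elements of \<^term>\<open>PiE I S\<close>, that is, functions that are
  \<^const>\<open>undefined\<close> outside \<open>I\<close>. A component is removed from a tuple by \<^const>\<open>restrict\<close>.
\<close>

record 'a game =
  num_players :: nat
  strategies :: "nat \<Rightarrow> 'a set"
  pref :: "nat \<Rightarrow> (nat \<Rightarrow> 'a) \<Rightarrow> 'a rel"

definition players :: "'a game \<Rightarrow> nat set" where
  "players G = {1..num_players G}"

definition joint_strategies :: "'a game \<Rightarrow> (nat \<Rightarrow> 'a) set" where
  "joint_strategies G = PiE (players G) (strategies G)"

definition opponent_strategies :: "'a game \<Rightarrow> nat \<Rightarrow> (nat \<Rightarrow> 'a) set" where
  "opponent_strategies G i = PiE (players G - {i}) (strategies G)"

definition strategic_game :: "'a game \<Rightarrow> bool" where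
  "strategic_game G \<longleftrightarrow>
    (\<forall>i\<in>players G. finite (strategies G i) \<and> strategies G i \<noteq> {} \<and>
      (\<forall>t\<in>opponent_strategies G i. preference_on (strategies G i) (pref G i t)))"

definition nash_equilibrium :: "'a game \<Rightarrow> (nat \<Rightarrow> 'a) \<Rightarrow> bool" where
  "nash_equilibrium G s \<longleftrightarrow> s \<in> joint_strategies G \<and>
    (\<forall>i\<in>players G. \<forall>a\<in>strategies G i.
      weakly_preferred (pref G i (restrict s (players G - {i}))) (s i) a)"

text \<open>
  The field \<open>pref_statement N i\<close> sends each complete assignment to the parents of variable \<open>i\<close> to the
  ordering in the unique preference statement for \<open>i\<close> under that assignment.
\<close>

record 'a cpnet =
  num_vars :: nat
  domain :: "nat \<Rightarrow> 'a set"
  parents :: "nat \<Rightarrow> nat set"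
  pref_statement :: "nat \<Rightarrow> (nat \<Rightarrow> 'a) \<Rightarrow> 'a rel"

definition vars :: "'a cpnet \<Rightarrow> nat set" where
  "vars N = {1..num_vars N}"

definition cp_net :: "'a cpnet \<Rightarrow> bool" where
  "cp_net N \<longleftrightarrow>
    (\<forall>i\<in>vars N. finite (domain N i) \<and> domain N i \<noteq> {} \<and>
      parents N i \<subseteq> vars N - {i} \<and>
      (\<forall>t\<in>PiE (parents N i) (domain N). preference_on (domain N i) (pref_statement N i t)))"

definition outcomes :: "'a cpnet \<Rightarrow> (nat \<Rightarrow> 'a) set" where
  "outcomes N = PiE (vars N) (domain N)"

definition worsening_flip :: "'a cpnet \<Rightarrow> (nat \<Rightarrow> 'a) \<Rightarrow> (nat \<Rightarrow> 'a) \<Rightarrow> bool" where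
  "worsening_flip N \<alpha> \<beta> \<longleftrightarrow> \<alpha> \<in> outcomes N \<and> \<beta> \<in> outcomes N \<and>
    (\<exists>i\<in>vars N. \<alpha> i \<noteq> \<beta> i \<and> (\<forall>j\<in>vars N - {i}. \<alpha> j = \<beta> j) \<and>
      (\<alpha> i, \<beta> i) \<in> pref_statement N i (restrict \<alpha> (parents N i)))"

definition better :: "'a cpnet \<Rightarrow> (nat \<Rightarrow> 'a) \<Rightarrow> (nat \<Rightarrow> 'a) \<Rightarrow> bool" where
  "better N = (worsening_flip N)\<^sup>+\<^sup>+"

definition optimal :: "'a cpnet \<Rightarrow> (nat \<Rightarrow> 'a) \<Rightarrow> bool" where
  "optimal N s \<longleftrightarrow> s \<in> outcomes N \<and> \<not> (\<exists>t\<in>outcomes N. better N t s)"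

definition cpnet_of_game :: "'a game \<Rightarrow> 'a cpnet" where
  "cpnet_of_game G =
    \<lparr>num_vars = num_players G,
     domain = strategies G,
     parents = (\<lambda>i. players G - {i}),
     pref_statement = pref G\<rparr>"

lemma cp_net_cpnet_of_game: "strategic_game G \<Longrightarrow> cp_net (cpnet_of_game G)"
  by (auto simp: strategic_game_def cp_net_def cpnet_of_game_def vars_def players_def
      opponent_strategies_def)

lemma outcomes_cpnet_of_game: "outcomes (cpnet_of_game G) = joint_strategies G"
  by (simp add: outcomes_def joint_strategies_def cpnet_of_game_def vars_def players_def)

end

theory Submission
  imports Defs
begin

text \<open>A chain of worsening flips ending in \<open>s\<close> has a last flip, so optimality
  only has to exclude single flips into \<open>s\<close>
  (\<open>optimal_iff_no_worsening_flip\<close>). In the net of a game the parents of a variable are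
  all the opponents, so a flip into \<open>s\<close> at \<open>i\<close> is a strategy that player
  \<open>i\<close> strictly prefers to \<open>s i\<close> while the others keep their choices
  (\<open>worsening_flip_into_iff\<close>). Since preferences are strict and total, the absence of
  such strategies is the Nash condition
  (\<open>weakly_preferred_iff_not_dispreferred\<close>).\<close>

lemma weakly_preferred_iff_not_dispreferred:
  assumes "preference_on A r" "a \<in> A" "b \<in> A"
  shows "weakly_preferred r a b \<longleftrightarrow> (b, a) \<notin> r"
  using assms unfolding preference_on_def strict_linear_order_on_def weakly_preferred_def
  by (metis irrefl_def total_on_def transD)

lemma optimal_iff_no_worsening_flip:
  "optimal N s \<longleftrightarrow> s \<in> outcomes N \<and> (\<forall>t. \<not> worsening_flip N t s)"
proof -
  have "\<exists>u. worsening_flip N u s" if "better N t s" for t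
    using that unfolding better_def by (metis tranclp.cases)
  moreover have "t \<in> outcomes N" if "worsening_flip N t s" for t
    using that by (simp add: worsening_flip_def)
  moreover have "better N t s" if "worsening_flip N t s" for t
    using that unfolding better_def by (rule tranclp.r_into_trancl[of "worsening_flip N"])
  ultimately show ?thesis
    unfolding optimal_def by blast
qed

text \<open>No variable is its own parent, so both ends of a flip at \<open>i\<close> agree on the
  parents of \<open>i\<close> and select the same preference statement. It can therefore be read off
  at \<open>s\<close> alone, which removes the other outcome \<open>t\<close> from the
  condition.\<close>

lemma worsening_flip_into_iff:
  assumes "s \<in> outcomes N" "\<And>i. i \<in> vars N \<Longrightarrow> parents N i \<subseteq> vars N - {i}"
    and irrefl: "\<And>i. i \<in> vars N \<Longrightarrow> (s i, s i) \<notin> pref_statement N i (restrict s (parents N i))"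
  shows "(\<exists>t. worsening_flip N t s) \<longleftrightarrow>
    (\<exists>i\<in>vars N. \<exists>a\<in>domain N i. (a, s i) \<in> pref_statement N i (restrict s (parents N i)))"
    (is "?L \<longleftrightarrow> ?R")
proof
  assume ?L
  then obtain t i where t: "t \<in> outcomes N" "i \<in> vars N" "\<forall>j\<in>vars N - {i}. t j = s j"
      "(t i, s i) \<in> pref_statement N i (restrict t (parents N i))"
    unfolding worsening_flip_def by blast
  moreover have "restrict t (parents N i) = restrict s (parents N i)"
    using t assms(2)[of i] by (intro restrict_ext) blast
  ultimately show ?R
    unfolding outcomes_def by (metis PiE_mem)
next
  assume ?R
  then obtain i a where i: "i \<in> vars N" "a \<in> domain N i"
      "(a, s i) \<in> pref_statement N i (restrict s (parents N i))"
    by blast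
  have "restrict (s(i := a)) (parents N i) = restrict s (parents N i)"
    using i assms(2)[of i] by (intro restrict_ext) auto
  moreover have "s(i := a) \<in> outcomes N"
    using i assms(1) unfolding outcomes_def by (auto simp: PiE_def extensional_def)
  \<comment> \<open>A flip must change the value of \<open>i\<close>; \<open>irrefl\<close> rules
    out \<open>a = s i\<close>.\<close>
  ultimately have "worsening_flip N (s(i := a)) s"
    unfolding worsening_flip_def using i assms(1) irrefl by (auto intro!: bexI[of _ i])
  then show ?L by blast
qed

theorem theorem2:
  fixes G :: "'a game" and s :: "nat \<Rightarrow> 'a"
  assumes "strategic_game G"
    and "s \<in> joint_strategies G"
  shows "nash_equilibrium G s \<longleftrightarrow> optimal (cpnet_of_game G) s"
proof -
  let ?N = "cpnet_of_game G"
  let ?r = "\<lambda>i. pref G i (restrict s (players G - {i}))"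
  have N: "vars ?N = players G" "domain ?N = strategies G" "pref_statement ?N = pref G"
      "parents ?N = (\<lambda>i. players G - {i})"
    by (simp_all add: cpnet_of_game_def vars_def players_def)
  have s: "s i \<in> strategies G i" if "i \<in> players G" for i
    using assms(2) that by (auto simp: joint_strategies_def)
  have r: "preference_on (strategies G i) (?r i)" if "i \<in> players G" for i
    using assms that s by (auto simp: strategic_game_def opponent_strategies_def)
  have irrefl: "(s i, s i) \<notin> ?r i" if "i \<in> players G" for i
    using r[OF that] by (auto simp: preference_on_def strict_linear_order_on_def irrefl_def)
  have "nash_equilibrium G s \<longleftrightarrow>
      (\<forall>i\<in>players G. \<forall>a\<in>strategies G i. (a, s i) \<notin> ?r i)"
    using assms(2) weakly_preferred_iff_not_dispreferred[OF r s]
    by (simp add: nash_equilibrium_def)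
  \<comment> \<open>Restricting \<open>s\<close> to the parents of \<open>i\<close> gives exactly
    the opponents' joint strategy, so both sides consult the same relation
    \<open>?r i\<close>.\<close>
  also have "\<dots> \<longleftrightarrow> \<not> (\<exists>t. worsening_flip ?N t s)"
    using assms(2) irrefl by (subst worsening_flip_into_iff) (auto simp: N outcomes_cpnet_of_game)
  also have "\<dots> \<longleftrightarrow> optimal ?N s"
    using assms(2) by (simp add: optimal_iff_no_worsening_flip outcomes_cpnet_of_game)
  finally show ?thesis .
qed

end
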